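(* Let $\mathcal{X},\mathcal{X}',\mathcal{Y},\mathcal{Y}'$ be finite sets, let $W\in\mathrm{DMC}_{\mathcal{X},\mathcal{Y}}$ and $W'\in\mathrm{DMC}_{\mathcal{X}',\mathcal{Y}'}$. Then $W'$ contains $W$ if and only if there exists a convex-product channel $V\in\mathrm{CPC}_{\mathcal{X}\times\mathcal{Y}',\mathcal{X}'\times\mathcal{Y}}$ such that $W=V\circ_s W'$.
   Context: For finite sets $\mathcal{A},\mathcal{B}$, $\mathrm{DMC}_{\mathcal{A},\mathcal{B}}$ is the set of channels from $\mathcal{A}$ to $\mathcal{B}$, i.e. families $W=(W(b|a))_{a\in\mathcal{A},b\in\mathcal{B}}$ of non-negative reals with $\sum_{b}W(b|a)=1$ for every $a$. $\Delta_{[n]}$ is the set of probability distributions on $[n]=\{1,\dots,n\}$. Composition: $(V\circ W)(c|a)=\sum_{b}V(c|b)W(b|a)$ for $W\in\mathrm{DMC}_{\mathcal{A},\mathcal{B}}$, $V\in\mathrm{DMC}_{\mathcal{B},\mathcal{C}}$. $W'\in\mathrm{DMC}_{\mathcal{X}',\mathcal{Y}'}$ contains $W\in\mathrm{DMC}_{\mathcal{X},\mathcal{Y}}$ if there exist $n\geq 1$, $\alpha\in\Delta_{[n]}$, $R_i\in\mathrm{DMC}_{\mathcal{X},\mathcal{X}'}$ and $T_i\in\mathrm{DMC}_{\mathcal{Y}',\mathcal{Y}}$ ($1\le i\le n$) such that $W=\sum_{i=1}^n\alpha(i)\,T_i\circ W'\circ R_i$. $\mathrm{CPC}_{\mathcal{X}\times\mathcal{Y}',\mathcal{X}'\times\mathcal{Y}}$,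 the set of convex-product channels, is the set of $V\in\mathrm{DMC}_{\mathcal{X}\times\mathcal{Y}',\mathcal{X}'\times\mathcal{Y}}$ for which there exist $n\ge 1$, $\alpha\in\Delta_{[n]}$, $R_i\in\mathrm{DMC}_{\mathcal{X},\mathcal{X}'}$, $T_i\in\mathrm{DMC}_{\mathcal{Y}',\mathcal{Y}}$ with $V(x',y|x,y')=\sum_{i=1}^n\alpha(i)R_i(x'|x)T_i(y|y')$. For $V\in\mathrm{CPC}_{\mathcal{X}\times\mathcal{Y}',\mathcal{X}'\times\mathcal{Y}}$ and $W'\in\mathrm{DMC}_{\mathcal{X}',\mathcal{Y}'}$, the skew-composition $V\circ_s W'\in\mathrm{DMC}_{\mathcal{X},\mathcal{Y}}$ is $(V\circ_s W')(y|x)=\sum_{x'\in\mathcal{X}',\,y'\in\mathcal{Y}'}V(x',y|x,y')W'(y'|x')$. *)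

theory Defs
  imports Complex_Main
begin

text \<open>
  A family of reals indexed by a set is represented by a total function that vanishes off that
  index set. The representation is thus unique, and HOL equality of two such functions is
  equality of the families. Alphabets are explicit sets, which may be empty.
\<close>

definition prob_dist :: "'a set \<Rightarrow> ('a \<Rightarrow> real) set" where
  "prob_dist A = {p. (\<forall>a\<in>A. 0 \<le> p a) \<and> (\<forall>a. a \<notin> A \<longrightarrow> p a = 0) \<and> (\<Sum>a\<in>A. p a) = 1}"

text \<open>The transition probability \<open>W(b|a)\<close> is written \<open>W a b\<close>: the input comes first.\<close>

definition DMC :: "'a set \<Rightarrow> 'b set \<Rightarrow> ('a \<Rightarrow> 'b \<Rightarrow> real) set" where
  "DMC A B = {W. (\<forall>a\<in>A. \<forall>b\<in>B. 0 \<le> W a b) \<and> (\<forall>a\<in>A. (\<Sum>b\<in>B. W a b) = 1) \<and>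
                 (\<forall>a b. a \<notin> A \<or> b \<notin> B \<longrightarrow> W a b = 0)}"

text \<open>
  \<open>chan_comp B V W\<close> is \<open>V \<circ> W\<close> (first \<open>W\<close>, then \<open>V\<close>), where \<open>B\<close> is the intermediate alphabet.
\<close>

definition chan_comp ::
  "'b set \<Rightarrow> ('b \<Rightarrow> 'c \<Rightarrow> real) \<Rightarrow> ('a \<Rightarrow> 'b \<Rightarrow> real) \<Rightarrow> 'a \<Rightarrow> 'c \<Rightarrow> real" where
  "chan_comp B V W = (\<lambda>a c. \<Sum>b\<in>B. V b c * W a b)"

text \<open>
  \<open>channel_contains X' Y' X Y W' W\<close>: the channel \<open>W'\<close> from \<open>X'\<close> to \<open>Y'\<close> contains the channel \<open>W\<close>
  from \<open>X\<close> to \<open>Y\<close>.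
\<close>

definition channel_contains ::
  "'x1 set \<Rightarrow> 'y1 set \<Rightarrow> 'x set \<Rightarrow> 'y set \<Rightarrow> ('x1 \<Rightarrow> 'y1 \<Rightarrow> real) \<Rightarrow> ('x \<Rightarrow> 'y \<Rightarrow> real) \<Rightarrow> bool" where
  "channel_contains X' Y' X Y W' W \<longleftrightarrow>
     (\<exists>(n::nat) \<alpha> R T. 1 \<le> n \<and> \<alpha> \<in> prob_dist {1..n} \<and>
        (\<forall>i\<in>{1..n}. R i \<in> DMC X X') \<and> (\<forall>i\<in>{1..n}. T i \<in> DMC Y' Y) \<and>
        W = (\<lambda>x y. \<Sum>i=1..n. \<alpha> i * chan_comp X' (chan_comp Y' (T i) W') (R i) x y))"

text \<open>\<open>V(x',y|x,y')\<close> is written \<open>V (x, y') (x', y)\<close>.\<close>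

definition CPC ::
  "'x set \<Rightarrow> 'y1 set \<Rightarrow> 'x1 set \<Rightarrow> 'y set \<Rightarrow> ('x \<times> 'y1 \<Rightarrow> 'x1 \<times> 'y \<Rightarrow> real) set" where
  "CPC X Y' X' Y = {V \<in> DMC (X \<times> Y') (X' \<times> Y).
     \<exists>(n::nat) \<alpha> R T. 1 \<le> n \<and> \<alpha> \<in> prob_dist {1..n} \<and>
        (\<forall>i\<in>{1..n}. R i \<in> DMC X X') \<and> (\<forall>i\<in>{1..n}. T i \<in> DMC Y' Y) \<and>
        (\<forall>x\<in>X. \<forall>y'\<in>Y'. \<forall>x'\<in>X'. \<forall>y\<in>Y.
           V (x, y') (x', y) = (\<Sum>i=1..n. \<alpha> i * R i x x' * T i y' y))}"

definition skew_comp ::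
  "'x1 set \<Rightarrow> 'y1 set \<Rightarrow> ('x \<times> 'y1 \<Rightarrow> 'x1 \<times> 'y \<Rightarrow> real) \<Rightarrow> ('x1 \<Rightarrow> 'y1 \<Rightarrow> real) \<Rightarrow> 'x \<Rightarrow> 'y \<Rightarrow> real" where
  "skew_comp X' Y' V W' = (\<lambda>x y. \<Sum>x'\<in>X'. \<Sum>y'\<in>Y'. V (x, y') (x', y) * W' x' y')"

end

theory Submission
  imports Defs
begin

text \<open>
  Interchanging finite sums shows that skew-composing \<open>W'\<close> with \<open>\<Sum>i. \<alpha> i R i T i\<close> gives
  \<open>\<Sum>i. \<alpha> i (T i \<circ> W' \<circ> R i)\<close>, so the same data \<open>n\<close>, \<open>\<alpha>\<close>, \<open>R\<close>, \<open>T\<close> witness both sides.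
\<close>

text \<open>No case distinction on the alphabets is built in: the required zeros off them are
  inherited from the factors \<open>R i\<close> and \<open>T i\<close>.\<close>

definition product_mixture ::
  "nat \<Rightarrow> (nat \<Rightarrow> real) \<Rightarrow> (nat \<Rightarrow> 'x \<Rightarrow> 'x1 \<Rightarrow> real) \<Rightarrow> (nat \<Rightarrow> 'y1 \<Rightarrow> 'y \<Rightarrow> real) \<Rightarrow>
     'x \<times> 'y1 \<Rightarrow> 'x1 \<times> 'y \<Rightarrow> real" where
  "product_mixture n \<alpha> R T = (\<lambda>(x, y') (x', y). \<Sum>i=1..n. \<alpha> i * R i x x' * T i y' y)"

lemma product_mixture_DMC:
  assumes \<alpha>: "\<alpha> \<in> prob_dist {1..n}"
    and R: "\<forall>i\<in>{1..n}. R i \<in> DMC X X'" and T: "\<forall>i\<in>{1..n}. T i \<in> DMC Y' Y"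
  shows "product_mixture n \<alpha> R T \<in> DMC (X \<times> Y') (X' \<times> Y)"
proof -
  have nonneg: "0 \<le> product_mixture n \<alpha> R T (x, y') (x', y)"
    if "x \<in> X" "y' \<in> Y'" "x' \<in> X'" "y \<in> Y" for x y' x' y
    using that \<alpha> R T
    by (auto simp: product_mixture_def DMC_def prob_dist_def intro!: sum_nonneg mult_nonneg_nonneg)
  have total: "(\<Sum>p\<in>X' \<times> Y. product_mixture n \<alpha> R T (x, y') p) = 1"
    if "x \<in> X" "y' \<in> Y'" for x y'
  proof -
    have "(\<Sum>p\<in>X' \<times> Y. product_mixture n \<alpha> R T (x, y') p)
        = (\<Sum>p\<in>X' \<times> Y. \<Sum>i=1..n. \<alpha> i * (R i x (fst p) * T i y' (snd p)))"
      by (simp add: product_mixture_def case_prod_beta mult.assoc)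
    also have "\<dots> = (\<Sum>i=1..n. \<alpha> i * (\<Sum>p\<in>X' \<times> Y. R i x (fst p) * T i y' (snd p)))"
      by (subst sum.swap) (simp add: sum_distrib_left)
    \<comment> \<open>For fixed \<open>i\<close>, the summand splits into a factor in
      \<open>x'\<close> and a factor in \<open>y\<close>, so the sum over pairs is a product of two
      row sums, each equal to 1.\<close>
    also have "\<dots> = (\<Sum>i=1..n. \<alpha> i * ((\<Sum>x'\<in>X'. R i x x') * (\<Sum>y\<in>Y. T i y' y)))"
      by (simp add: sum_product sum.cartesian_product case_prod_beta)
    also have "\<dots> = (\<Sum>i=1..n. \<alpha> i)"
      using that R T by (intro sum.cong) (auto simp: DMC_def)
    also have "\<dots> = 1"
      using \<alpha> by (simp add: prob_dist_def)
    finally show ?thesis .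
  qed
  \<comment> \<open>A bad \<open>x\<close> or \<open>x'\<close> kills the factor
    \<open>R i x x'\<close>, a bad \<open>y'\<close> or \<open>y\<close> kills
    \<open>T i y' y\<close>, so every summand vanishes.\<close>
  have zero: "product_mixture n \<alpha> R T (x, y') (x', y) = 0"
    if "x \<notin> X \<or> y' \<notin> Y' \<or> x' \<notin> X' \<or> y \<notin> Y" for x y' x' y
    using that R T by (auto simp: product_mixture_def DMC_def intro!: sum.neutral)
  show ?thesis
    unfolding DMC_def using nonneg total zero by auto
qed

text \<open>Off \<open>A\<close> and \<open>B\<close> both functions vanish by the support
  convention, so only entries on the alphabets matter.\<close>

lemma DMC_eqI:
  assumes "V \<in> DMC A B" "U \<in> DMC A B" "\<And>a b. a \<in> A \<Longrightarrow> b \<in> B \<Longrightarrow> V a b = U a b"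
  shows "V = U"
proof (intro ext)
  fix a b
  show "V a b = U a b"
    using assms by (cases "a \<in> A \<and> b \<in> B") (auto simp: DMC_def)
qed

text \<open>Upgrades the entrywise condition in \<open>CPC\<close> to an equality of functions, so
  that \<open>V\<close> can be eliminated by substitution in the theorem. Both sides of that
  equality are channels, hence agree off the alphabets as well.\<close>

lemma CPC_iff_product_mixture:
  "V \<in> CPC X Y' X' Y \<longleftrightarrow>
    (\<exists>n \<alpha> R T. 1 \<le> n \<and> \<alpha> \<in> prob_dist {1..n} \<and>
       (\<forall>i\<in>{1..n}. R i \<in> DMC X X') \<and> (\<forall>i\<in>{1..n}. T i \<in> DMC Y' Y) \<and>
       V = product_mixture n \<alpha> R T)" (is "?L \<longleftrightarrow> ?R")
proof
  assume ?L
  then obtain n :: nat and \<alpha> R T where V: "V \<in> DMC (X \<times> Y') (X' \<times> Y)"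
    and w: "1 \<le> n" "\<alpha> \<in> prob_dist {1..n}"
      "\<forall>i\<in>{1..n}. R i \<in> DMC X X'" "\<forall>i\<in>{1..n}. T i \<in> DMC Y' Y"
    and eq: "\<forall>x\<in>X. \<forall>y'\<in>Y'. \<forall>x'\<in>X'. \<forall>y\<in>Y.
           V (x, y') (x', y) = (\<Sum>i=1..n. \<alpha> i * R i x x' * T i y' y)"
    unfolding CPC_def by blast
  have "V = product_mixture n \<alpha> R T"
    by (rule DMC_eqI[OF V product_mixture_DMC[OF w(2-4)]])
      (use eq in \<open>auto simp: product_mixture_def\<close>)
  with w show ?R by blast
next
  assume ?R
  then obtain n \<alpha> R T where w: "1 \<le> n" "\<alpha> \<in> prob_dist {1..n}"
      "\<forall>i\<in>{1..n}. R i \<in> DMC X X'" "\<forall>i\<in>{1..n}. T i \<in> DMC Y' Y"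
    and V: "V = product_mixture n \<alpha> R T"
    by blast
  have "\<forall>x\<in>X. \<forall>y'\<in>Y'. \<forall>x'\<in>X'. \<forall>y\<in>Y.
      V (x, y') (x', y) = (\<Sum>i=1..n. \<alpha> i * R i x x' * T i y' y)"
    by (simp add: V product_mixture_def)
  then show ?L
    unfolding CPC_def using w product_mixture_DMC[OF w(2-4)] V by blast
qed

lemma skew_comp_product_mixture:
  "skew_comp X' Y' (product_mixture n \<alpha> R T) W' =
    (\<lambda>x y. \<Sum>i=1..n. \<alpha> i * chan_comp X' (chan_comp Y' (T i) W') (R i) x y)"
proof (intro ext)
  fix x y
  \<comment> \<open>The factors are ordered as in the expansion of the nested
    \<open>chan_comp\<close>; it remains to move the sum over \<open>i\<close> outward, first past
    \<open>y'\<close>, then past \<open>x'\<close>.\<close>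
  have "skew_comp X' Y' (product_mixture n \<alpha> R T) W' x y
      = (\<Sum>x'\<in>X'. \<Sum>y'\<in>Y'. \<Sum>i=1..n. \<alpha> i * (T i y' y * W' x' y' * R i x x'))"
    by (simp add: skew_comp_def product_mixture_def sum_distrib_left mult_ac)
  also have "\<dots> = (\<Sum>x'\<in>X'. \<Sum>i=1..n. \<Sum>y'\<in>Y'. \<alpha> i * (T i y' y * W' x' y' * R i x x'))"
    by (intro sum.cong refl sum.swap)
  also have "\<dots> = (\<Sum>i=1..n. \<Sum>x'\<in>X'. \<Sum>y'\<in>Y'. \<alpha> i * (T i y' y * W' x' y' * R i x x'))"
    by (rule sum.swap)
  also have "\<dots> = (\<Sum>i=1..n. \<alpha> i * chan_comp X' (chan_comp Y' (T i) W') (R i) x y)"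
    by (simp add: chan_comp_def sum_distrib_left sum_distrib_right)
  finally show "skew_comp X' Y' (product_mixture n \<alpha> R T) W' x y =
      (\<Sum>i=1..n. \<alpha> i * chan_comp X' (chan_comp Y' (T i) W') (R i) x y)" .
qed

theorem lemma3:
  fixes X :: "'x set" and X' :: "'x1 set" and Y :: "'y set" and Y' :: "'y1 set"
    and W :: "'x \<Rightarrow> 'y \<Rightarrow> real" and W' :: "'x1 \<Rightarrow> 'y1 \<Rightarrow> real"
  assumes "finite X" and "finite X'" and "finite Y" and "finite Y'"
    and "W \<in> DMC X Y" and "W' \<in> DMC X' Y'"
  shows "channel_contains X' Y' X Y W' W \<longleftrightarrow>
    (\<exists>V\<in>CPC X Y' X' Y. W = skew_comp X' Y' V W')"
  \<comment> \<open>After rewriting, both sides quantify over the same \<open>n\<close>, \<alpha>,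
    \<open>R\<close>, \<open>T\<close> with the same equation for \<open>W\<close>; only
    \<open>V\<close>, fixed by an equation, is left to eliminate.\<close>
  unfolding channel_contains_def Bex_def CPC_iff_product_mixture
    skew_comp_product_mixture[symmetric]
  by blast

end
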